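(* Let $n,m\in\mathbb{N}$, $A\in\mathbb{R}^{n\times n}$ and $x_0\in\mathbb{R}^n$, and let the data $(x_i)_{i=0}^m$ be generated by $x_{i+1}=Ax_i$ for $i=0,\ldots,m-1$. Let $X=[x_0\ \cdots\ x_{m-1}]$, $Z=[x_1\ \cdots\ x_m]\in\mathbb{R}^{n\times m}$, let $A_{\mathrm{DMD}}=ZX^\dagger$ be the corresponding DMD matrix, let $r=\operatorname{rank}(X)$, and let $X=U\Sigma V^\top$ be the trimmed singular value decomposition of $X$ with $U\in\mathbb{R}^{n\times r}$, $\Sigma\in\mathbb{R}^{r\times r}$ nonsingular and $V\in\mathbb{R}^{m\times r}$. If $\operatorname{span}\{U\}$ is $A_{\mathrm{DMD}}$-invariant, then the DMD approximation is exact in the image of $U$, i.e., $$(A^i-A_{\mathrm{DMD}}^i)x=0\qquad\text{for all integers } i\ge 0 \text{ and all } x\in\operatorname{span}\{U\}.$$ If in addition $\ker(A)\cap\operatorname{span}\{U\}^\perp=\{0\}$, then also the converse direction holds, i.e., if $(A^i-A_{\mathrm{DMD}}^i)x=0$ for all integers $i\ge 0$ and all $x\in\operatorname{span}\{U\}$, then $\operatorname{span}\{U\}$ is $A_{\mathrm{DMD}}$-invariant.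
   Context: $M^\dagger$ denotes the Moore-Penrose pseudoinverse of a real matrix $M$. The matrix $A_{\mathrm{DMD}}=ZX^\dagger$ is called the DMD (dynamic mode decomposition) matrix of the data $(x_i)_{i=0}^m$. The trimmed singular value decomposition of a matrix $X\in\mathbb{R}^{n\times m}$ of rank $r$ is $X=U\Sigma V^\top$ with $U\in\mathbb{R}^{n\times r}$, $V\in\mathbb{R}^{m\times r}$ having orthonormal columns ($U^\top U=V^\top V=I_r$) and $\Sigma\in\mathbb{R}^{r\times r}$ diagonal with the nonzero singular values of $X$ on its diagonal. $\operatorname{span}\{U\}$ denotes the column space of $U$, and $\operatorname{span}\{U\}^\perp$ its orthogonal complement in $\mathbb{R}^n$. A subspace $W\subseteq\mathbb{R}^n$ is $A_{\mathrm{DMD}}$-invariant if $A_{\mathrm{DMD}}x\in W$ for all $x\in W$. *)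

theory Defs
  imports
    "Jordan_Normal_Form.Matrix_Kernel"
    "Jordan_Normal_Form.Char_Poly"
    "Jordan_Normal_Form.DL_Rank"
begin

definition is_pseudoinverse :: "real mat \<Rightarrow> real mat \<Rightarrow> bool" where
  "is_pseudoinverse M Y \<longleftrightarrow>
     Y \<in> carrier_mat (dim_col M) (dim_row M) \<and>
     M * Y * M = M \<and>
     Y * M * Y = Y \<and>
     transpose_mat (M * Y) = M * Y \<and>
     transpose_mat (Y * M) = Y * M"

lemma is_pseudoinverse_unique:
  assumes Y: "is_pseudoinverse M Y" and W: "is_pseudoinverse M W"
  shows "Y = W"
proof -
  define a b where "a = dim_row M" and "b = dim_col M"
  have M: "M \<in> carrier_mat a b"
    by (simp add: a_def b_def carrier_mat_triv)
  have Yc: "Y \<in> carrier_mat b a" and Wc: "W \<in> carrier_mat b a"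
    using Y W unfolding is_pseudoinverse_def a_def b_def by blast+
  have y: "M * Y * M = M" "Y * M * Y = Y" "transpose_mat (M * Y) = M * Y"
      "transpose_mat (Y * M) = Y * M"
    using Y unfolding is_pseudoinverse_def by blast+
  have w: "M * W * M = M" "W * M * W = W" "transpose_mat (M * W) = M * W"
      "transpose_mat (W * M) = W * M"
    using W unfolding is_pseudoinverse_def by blast+
  have MY: "M * Y \<in> carrier_mat a a" and MW: "M * W \<in> carrier_mat a a"
    and YM: "Y * M \<in> carrier_mat b b" and WM: "W * M \<in> carrier_mat b b"
    using M Yc Wc by auto
  have "(M * W) * (M * Y) = M * Y"
    using assoc_mult_mat[OF MW M Yc] by (simp only: w(1))
  moreover have "transpose_mat ((M * W) * (M * Y)) = (M * Y) * (M * W)"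
    using transpose_mult[OF MW MY] by (simp only: y(3) w(3))
  moreover have "(M * Y) * (M * W) = M * W"
    using assoc_mult_mat[OF MY M Wc] by (simp only: y(1))
  ultimately have 1: "M * Y = M * W"
    by (metis y(3))
  have "(Y * M) * (W * M) = Y * M"
    using assoc_mult_mat[OF Yc M WM] assoc_mult_mat[OF M Wc M] by (simp only: w(1))
  moreover have "transpose_mat ((Y * M) * (W * M)) = (W * M) * (Y * M)"
    using transpose_mult[OF YM WM] by (simp only: y(4) w(4))
  moreover have "(W * M) * (Y * M) = W * M"
    using assoc_mult_mat[OF Wc M YM] assoc_mult_mat[OF M Yc M] by (simp only: y(1))
  ultimately have 2: "Y * M = W * M"
    by (metis y(4))
  have "Y = Y * M * Y" by (rule y(2)[symmetric])
  also have "\<dots> = W * M * Y" by (simp only: 2)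
  also have "\<dots> = W * (M * Y)" by (rule assoc_mult_mat[OF Wc M Yc])
  also have "\<dots> = W * (M * W)" by (simp only: 1)
  also have "\<dots> = W * M * W" by (rule assoc_mult_mat[OF Wc M Wc, symmetric])
  also have "\<dots> = W" by (rule w(2))
  finally show ?thesis .
qed

definition pseudoinverse :: "real mat \<Rightarrow> real mat" where
  "pseudoinverse M = (THE Y. is_pseudoinverse M Y)"

lemma pseudoinverse_eqI: "is_pseudoinverse M Y \<Longrightarrow> pseudoinverse M = Y"
  unfolding pseudoinverse_def using is_pseudoinverse_unique by blast

(* Square roots of the eigenvalues of X^T X, with algebraic multiplicity. All eigenvalues of this
   symmetric positive semidefinite matrix are real, so the real roots of its characteristic
   polynomial exhaust the spectrum. *)
definition singular_values :: "real mat \<Rightarrow> real multiset" where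
  "singular_values X = image_mset sqrt (proots (char_poly (transpose_mat X * X)))"

abbreviation mat_rank :: "real mat \<Rightarrow> nat" where
  "mat_rank M \<equiv> vec_space.rank (dim_row M) M"

(* No ordering of the singular values along the diagonal is imposed. *)
definition trimmed_svd :: "real mat \<Rightarrow> real mat \<Rightarrow> real mat \<Rightarrow> real mat \<Rightarrow> bool" where
  "trimmed_svd X U S V \<longleftrightarrow>
     U \<in> carrier_mat (dim_row X) (mat_rank X) \<and>
     S \<in> carrier_mat (mat_rank X) (mat_rank X) \<and>
     V \<in> carrier_mat (dim_col X) (mat_rank X) \<and>
     transpose_mat U * U = 1\<^sub>m (mat_rank X) \<and>
     transpose_mat V * V = 1\<^sub>m (mat_rank X) \<and>
     diagonal_mat S \<and>
     mset (diag_mat S) = filter_mset (\<lambda>s. s \<noteq> 0) (singular_values X) \<and>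
     X = U * S * transpose_mat V"

lemma trimmed_svd_det_nonzero:
  assumes "trimmed_svd X U S V"
  shows "det S \<noteq> 0"
proof -
  have S: "S \<in> carrier_mat (mat_rank X) (mat_rank X)" and d: "diagonal_mat S"
    and m: "mset (diag_mat S) = filter_mset (\<lambda>s. s \<noteq> 0) (singular_values X)"
    using assms unfolding trimmed_svd_def by blast+
  have "upper_triangular S"
    using d S by (auto simp: diagonal_mat_def upper_triangular_def)
  then have "det S = prod_list (diag_mat S)"
    using S by (rule det_upper_triangular)
  moreover have "0 \<notin> set (diag_mat S)"
  proof -
    have "0 \<notin># mset (diag_mat S)" unfolding m by simp
    then show ?thesis by simp
  qed
  ultimately show ?thesis by simp
qed

abbreviation column_space :: "real mat \<Rightarrow> real vec set" where
  "column_space M \<equiv> vec_space.col_space (dim_row M) M"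

definition mat_invariant :: "real mat \<Rightarrow> real vec set \<Rightarrow> bool" where
  "mat_invariant M W \<longleftrightarrow> (\<forall>v\<in>W. M *\<^sub>v v \<in> W)"

end

theory Submission
  imports Defs
begin

text \<open>
  Because the data obey \<open>x (Suc i) = A x i\<close>, the shifted data matrix is \<open>Z = A X\<close>, so the DMD matrix is
  \<open>A X X\<^sup>\<dagger>\<close>. The trimmed singular value decomposition gives \<open>X\<^sup>\<dagger> = V S\<^sup>-\<^sup>1 U\<^sup>T\<close>, hence
  \<open>X X\<^sup>\<dagger> = U U\<^sup>T =: P\<close> is the orthogonal projection onto the column space \<open>W\<close> of \<open>U\<close>. Thus
  the DMD matrix is \<open>A P\<close>, and everything follows from the behaviour of \<open>A P\<close> on \<open>W\<close>, where it agrees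
  with \<open>A\<close>.

  If \<open>W\<close> is invariant, the orbits under \<open>A P\<close> of vectors in \<open>W\<close> never leave the set on which
  both matrices agree, so all powers agree (\<open>pow_mat_mult_vec_eq_on_invariant\<close>). Conversely, the
  second powers alone give \<open>A (A v) = A (P (A v))\<close> for \<open>v \<in> W\<close>: the component \<open>A v - P (A v)\<close>
  of \<open>A v\<close> orthogonal to \<open>W\<close> lies in the kernel of \<open>A\<close>. If that kernel meets the orthogonal
  complement of \<open>W\<close> trivially, then \<open>A v = P (A v)\<close>, which puts \<open>A v = A P v\<close> into \<open>W\<close>
  (\<open>mult_projection_invariant_of_square\<close>).
\<close>

section \<open>The pseudoinverse from a singular value decomposition\<close>

lemma mult_mat_cancel_middle:
  fixes P Q R W :: "'a :: semiring_1 mat"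
  assumes P: "P \<in> carrier_mat a r" and Q: "Q \<in> carrier_mat r b"
    and R: "R \<in> carrier_mat b r" and W: "W \<in> carrier_mat r c"
    and QR: "Q * R = 1\<^sub>m r"
  shows "(P * Q) * (R * W) = P * W"
proof -
  have "(P * Q) * (R * W) = P * (Q * (R * W))"
    using P Q R W by (intro assoc_mult_mat) auto
  also have "Q * (R * W) = (Q * R) * W"
    using Q R W by (intro assoc_mult_mat[symmetric]) auto
  finally show ?thesis using QR W by simp
qed

text \<open>
  The pseudoinverse is \<open>V T U\<^sup>T\<close> for the inverse \<open>T\<close> of \<open>S\<close>. The factors \<open>S\<close> and \<open>T\<close> cancel in both
  products with \<open>X\<close>, leaving the manifestly symmetric \<open>U U\<^sup>T\<close> and \<open>V V\<^sup>T\<close>.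
\<close>

lemma mult_pseudoinverse_of_orthonormal_factors:
  fixes U S V :: "real mat"
  assumes U: "U \<in> carrier_mat n r" and S: "S \<in> carrier_mat r r" and V: "V \<in> carrier_mat m r"
    and UU: "transpose_mat U * U = 1\<^sub>m r" and VV: "transpose_mat V * V = 1\<^sub>m r"
    and det: "det S \<noteq> 0"
    and X: "X = U * S * transpose_mat V"
  shows "pseudoinverse X \<in> carrier_mat m n" and "X * pseudoinverse X = U * transpose_mat U"
proof -
  obtain T where T: "T \<in> carrier_mat r r" and TS: "T * S = 1\<^sub>m r" and ST: "S * T = 1\<^sub>m r"
    using det_non_zero_imp_unit[OF S det, of "()"] by (auto simp: Units_def ring_mat_def)
  define Y where "Y = V * T * transpose_mat U"
  have Ut: "transpose_mat U \<in> carrier_mat r n" and Vt: "transpose_mat V \<in> carrier_mat r m"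
    using U V by auto
  have US: "U * S \<in> carrier_mat n r" and VT: "V * T \<in> carrier_mat m r"
    and SV: "S * transpose_mat V \<in> carrier_mat r m" and TU: "T * transpose_mat U \<in> carrier_mat r n"
    using U S V T by auto
  have X': "X = U * (S * transpose_mat V)"
    unfolding X by (rule assoc_mult_mat[OF U S Vt])
  have Y': "Y = V * (T * transpose_mat U)"
    unfolding Y_def by (rule assoc_mult_mat[OF V T Ut])
  have "X * Y = (U * S) * (T * transpose_mat U)"
    unfolding X Y' by (rule mult_mat_cancel_middle[OF US Vt V TU VV])
  also have "\<dots> = U * transpose_mat U"
    by (rule mult_mat_cancel_middle[OF U S T Ut ST])
  finally have XY: "X * Y = U * transpose_mat U" .
  have "Y * X = (V * T) * (S * transpose_mat V)"
    unfolding X' Y_def by (rule mult_mat_cancel_middle[OF VT Ut U SV UU])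
  also have "\<dots> = V * transpose_mat V"
    by (rule mult_mat_cancel_middle[OF V T S Vt TS])
  finally have YX: "Y * X = V * transpose_mat V" .
  have Xc: "X \<in> carrier_mat n m" and Yc: "Y \<in> carrier_mat m n"
    unfolding X Y_def using US Vt VT Ut by auto
  have "X * Y * X = X"
    unfolding XY unfolding X' by (rule mult_mat_cancel_middle[OF U Ut U SV UU])
  moreover have "Y * X * Y = Y"
    unfolding YX unfolding Y' by (rule mult_mat_cancel_middle[OF V Vt V TU VV])
  moreover have "transpose_mat (X * Y) = X * Y"
    unfolding XY transpose_mult[OF U Ut] by simp
  moreover have "transpose_mat (Y * X) = Y * X"
    unfolding YX transpose_mult[OF V Vt] by simp
  ultimately have "is_pseudoinverse X Y"
    unfolding is_pseudoinverse_def using Xc Yc by auto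
  then have "pseudoinverse X = Y" by (rule pseudoinverse_eqI)
  then show "pseudoinverse X \<in> carrier_mat m n" and "X * pseudoinverse X = U * transpose_mat U"
    using Yc XY by auto
qed

section \<open>Orthogonal projection onto a column space\<close>

lemma minus_vec_eq_zero_iff:
  fixes a b :: "'a :: group_add vec"
  assumes "a \<in> carrier_vec n" and "b \<in> carrier_vec n"
  shows "a - b = 0\<^sub>v n \<longleftrightarrow> a = b"
  using assms by (auto simp: vec_eq_iff)

lemma column_space_eq_image:
  assumes "U \<in> carrier_mat n r"
  shows "column_space U = {U *\<^sub>v y | y. y \<in> carrier_vec r}"
proof -
  have "column_space U = {w \<in> carrier_vec n. \<exists>y \<in> carrier_vec r. U *\<^sub>v y = w}"
    using vec_space.col_space_eq[OF assms] assms by auto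
  then show ?thesis using assms by auto
qed

lemma mult_transpose_fixes_column_space:
  fixes U :: "real mat"
  assumes U: "U \<in> carrier_mat n r" and UU: "transpose_mat U * U = 1\<^sub>m r"
    and v: "v \<in> column_space U"
  shows "(U * transpose_mat U) *\<^sub>v v = v"
proof -
  obtain y where y: "y \<in> carrier_vec r" and vy: "v = U *\<^sub>v y"
    using v unfolding column_space_eq_image[OF U] by auto
  have Ut: "transpose_mat U \<in> carrier_mat r n" using U by auto
  have "(U * transpose_mat U) *\<^sub>v v = U *\<^sub>v (transpose_mat U *\<^sub>v (U *\<^sub>v y))"
    unfolding vy using U Ut y by (intro assoc_mult_mat_vec) auto
  also have "transpose_mat U *\<^sub>v (U *\<^sub>v y) = (transpose_mat U * U) *\<^sub>v y"
    by (rule assoc_mult_mat_vec[OF Ut U y, symmetric])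
  finally show ?thesis using y UU vy by simp
qed

text \<open>The residual is killed by \<open>U\<^sup>T\<close>, and \<open>w \<bullet> U y = U\<^sup>T w \<bullet> y\<close>.\<close>

lemma projection_residual_orthogonal:
  fixes U :: "real mat"
  assumes U: "U \<in> carrier_mat n r" and UU: "transpose_mat U * U = 1\<^sub>m r"
    and w: "w \<in> carrier_vec n"
  shows "w - (U * transpose_mat U) *\<^sub>v w \<in> vec_module.orthogonal_complement n (column_space U)"
proof -
  have Ut: "transpose_mat U \<in> carrier_mat r n" using U by auto
  define p where "p = (U * transpose_mat U) *\<^sub>v w"
  have p: "p = U *\<^sub>v (transpose_mat U *\<^sub>v w)"
    unfolding p_def by (rule assoc_mult_mat_vec[OF U Ut w])
  have pc: "p \<in> carrier_vec n" unfolding p using U Ut w by auto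
  have wp: "w - p \<in> carrier_vec n" using w pc by auto
  have Utw: "transpose_mat U *\<^sub>v w \<in> carrier_vec r" using Ut w by auto
  have "transpose_mat U *\<^sub>v p = (transpose_mat U * U) *\<^sub>v (transpose_mat U *\<^sub>v w)"
    unfolding p by (rule assoc_mult_mat_vec[OF Ut U Utw, symmetric])
  also have "\<dots> = transpose_mat U *\<^sub>v w" using UU Utw by simp
  finally have "transpose_mat U *\<^sub>v (w - p) = 0\<^sub>v r"
    using mult_minus_distrib_mat_vec[OF Ut w pc] Utw by simp
  then have "(w - p) \<bullet> (U *\<^sub>v y) = 0" if y: "y \<in> carrier_vec r" for y
    using transpose_vec_mult_scalar[OF U y wp] y by simp
  then show ?thesis
    unfolding vec_module.orthogonal_complement_def column_space_eq_image[OF U]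
    using wp unfolding p_def by auto
qed

section \<open>Powers on an invariant subspace\<close>

lemma pow_mat_mult_vec_eq_on_invariant:
  assumes A: "A \<in> carrier_mat n n" and B: "B \<in> carrier_mat n n"
    and W: "W \<subseteq> carrier_vec n" and inv: "mat_invariant B W"
    and eq: "\<And>v. v \<in> W \<Longrightarrow> B *\<^sub>v v = A *\<^sub>v v"
    and v: "v \<in> W"
  shows "B ^\<^sub>m i *\<^sub>v v = A ^\<^sub>m i *\<^sub>v v"
  using v
proof (induction i arbitrary: v)
  case 0
  then show ?case using A B by auto
next
  case (Suc i)
  have vc: "v \<in> carrier_vec n" using Suc.prems W by auto
  have Bv: "B *\<^sub>v v \<in> W" using inv Suc.prems unfolding mat_invariant_def by auto
  have "B ^\<^sub>m Suc i *\<^sub>v v = B ^\<^sub>m i *\<^sub>v (B *\<^sub>v v)"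
    using assoc_mult_mat_vec[OF pow_carrier_mat[OF B] B vc] by simp
  also have "\<dots> = A ^\<^sub>m i *\<^sub>v (A *\<^sub>v v)"
    using Suc.IH[OF Bv] eq[OF Suc.prems] by simp
  also have "\<dots> = A ^\<^sub>m Suc i *\<^sub>v v"
    using assoc_mult_mat_vec[OF pow_carrier_mat[OF A] A vc] by simp
  finally show ?case .
qed

text \<open>
  For \<open>v\<close> in the column space, agreement of the second powers says that \<open>A\<close> cannot see the
  residual \<open>A v - P (A v)\<close>, with \<open>P = U U\<^sup>T\<close>.
\<close>

lemma mult_projection_invariant_of_square:
  fixes A U :: "real mat"
  assumes A: "A \<in> carrier_mat n n" and U: "U \<in> carrier_mat n r"
    and UU: "transpose_mat U * U = 1\<^sub>m r"
    and B: "B = A * (U * transpose_mat U)"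
    and ker: "mat_kernel A \<inter> vec_module.orthogonal_complement n (column_space U) = {0\<^sub>v n}"
    and sq: "\<And>v. v \<in> column_space U \<Longrightarrow> A ^\<^sub>m 2 *\<^sub>v v = B ^\<^sub>m 2 *\<^sub>v v"
  shows "mat_invariant B (column_space U)"
  unfolding mat_invariant_def
proof
  fix v assume v: "v \<in> column_space U"
  let ?P = "U * transpose_mat U"
  have P: "?P \<in> carrier_mat n n" using U by auto
  have Bc: "B \<in> carrier_mat n n" unfolding B using A P by auto
  have vc: "v \<in> carrier_vec n" using v U unfolding column_space_eq_image[OF U] by auto
  define w where "w = A *\<^sub>v v"
  have w: "w \<in> carrier_vec n" unfolding w_def using A vc by auto
  have Pw: "?P *\<^sub>v w \<in> carrier_vec n" using P w by auto
  have Bv: "B *\<^sub>v v = w"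
    using assoc_mult_mat_vec[OF A P vc] mult_transpose_fixes_column_space[OF U UU v]
    unfolding B w_def by simp
  have square: "M ^\<^sub>m 2 *\<^sub>v v = M *\<^sub>v (M *\<^sub>v v)" if "M \<in> carrier_mat n n" for M :: "real mat"
    using that vc by (simp add: numeral_2_eq_2)
  have "A *\<^sub>v w = B *\<^sub>v w"
    using sq[OF v] square[OF A] square[OF Bc] Bv w_def by simp
  also have "\<dots> = A *\<^sub>v (?P *\<^sub>v w)"
    unfolding B by (rule assoc_mult_mat_vec[OF A P w])
  finally have "A *\<^sub>v (w - ?P *\<^sub>v w) = 0\<^sub>v n"
    using mult_minus_distrib_mat_vec[OF A w Pw] A Pw by simp
  then have "w - ?P *\<^sub>v w \<in> mat_kernel A"
    using A w Pw by (intro mat_kernelI[OF A]) auto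
  then have "w - ?P *\<^sub>v w = 0\<^sub>v n"
    using ker projection_residual_orthogonal[OF U UU w] by blast
  then have "w = ?P *\<^sub>v w"
    using minus_vec_eq_zero_iff[OF w Pw] by simp
  also have "\<dots> = U *\<^sub>v (transpose_mat U *\<^sub>v w)"
    using U w by (intro assoc_mult_mat_vec) auto
  finally show "B *\<^sub>v v \<in> column_space U"
    unfolding Bv column_space_eq_image[OF U] using U w by auto
qed

section \<open>Exactness of dynamic mode decomposition\<close>

text \<open>Column by column, \<open>Z = A X\<close> is the recursion itself.\<close>

lemma shifted_data_eq_mult:
  assumes A: "A \<in> carrier_mat n n" and x0: "x 0 \<in> carrier_vec n"
    and data: "\<And>i. i < m \<Longrightarrow> x (Suc i) = A *\<^sub>v x i"
  shows "mat_of_cols n (map x [1..<Suc m]) = A * mat_of_cols n (map x [0..<m])"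
    (is "?Z = A * ?X")
proof (rule mat_col_eqI)
  have xc: "x i \<in> carrier_vec n" if "i \<le> m" for i
    using that by (induction i) (use x0 A data in auto)
  have X: "?X \<in> carrier_mat n m" by auto
  show "dim_row ?Z = dim_row (A * ?X)" "dim_col ?Z = dim_col (A * ?X)" using A by auto
  fix j assume "j < dim_col (A * ?X)"
  then have j: "j < m" by simp
  have "col ?Z j = x (Suc j)"
    using j xc[of "Suc j"] by (subst col_mat_of_cols) (auto simp del: upt_Suc)
  also have "\<dots> = A *\<^sub>v x j" by (rule data[OF j])
  also have "x j = col ?X j"
    using j xc[of j] by (subst col_mat_of_cols) auto
  also have "A *\<^sub>v col ?X j = col (A * ?X) j"
    by (rule col_mult2[OF A X j, symmetric])
  finally show "col ?Z j = col (A * ?X) j" .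
qed

theorem theorem3p7:
  fixes n m :: nat
    and A X Z A_DMD U S V :: "real mat"
    and x :: "nat \<Rightarrow> real vec"
  assumes A: "A \<in> carrier_mat n n"
    and x0: "x 0 \<in> carrier_vec n"
    and data: "\<And>i. i < m \<Longrightarrow> x (Suc i) = A *\<^sub>v x i"
    and X: "X = mat_of_cols n (map x [0..<m])"
    and Z: "Z = mat_of_cols n (map x [1..<Suc m])"
    and A_DMD: "A_DMD = Z * pseudoinverse X"
    and svd: "trimmed_svd X U S V"
  shows "(mat_invariant A_DMD (column_space U) \<longrightarrow>
            (\<forall>i::nat. \<forall>v\<in>column_space U. (A ^\<^sub>m i - A_DMD ^\<^sub>m i) *\<^sub>v v = 0\<^sub>v n)) \<and>
         (mat_kernel A \<inter> vec_module.orthogonal_complement n (column_space U) = {0\<^sub>v n} \<longrightarrow>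
            (\<forall>i::nat. \<forall>v\<in>column_space U. (A ^\<^sub>m i - A_DMD ^\<^sub>m i) *\<^sub>v v = 0\<^sub>v n) \<longrightarrow>
            mat_invariant A_DMD (column_space U))"
proof -
  define r where "r = mat_rank X"
  let ?P = "U * transpose_mat U"
  have Xc: "X \<in> carrier_mat n m" unfolding X by auto
  have U: "U \<in> carrier_mat n r" and S: "S \<in> carrier_mat r r" and V: "V \<in> carrier_mat m r"
    and UU: "transpose_mat U * U = 1\<^sub>m r" and VV: "transpose_mat V * V = 1\<^sub>m r"
    and XUSV: "X = U * S * transpose_mat V"
    using svd Xc unfolding trimmed_svd_def r_def by auto
  note pinv = mult_pseudoinverse_of_orthonormal_factors
    [OF U S V UU VV trimmed_svd_det_nonzero[OF svd] XUSV]
  have "A_DMD = A * X * pseudoinverse X"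
    unfolding A_DMD Z X by (simp only: shifted_data_eq_mult[OF A x0 data])
  also have "\<dots> = A * ?P"
    unfolding assoc_mult_mat[OF A Xc pinv(1)] pinv(2) ..
  finally have B: "A_DMD = A * ?P" .
  have P: "?P \<in> carrier_mat n n" using U by auto
  have Bc: "A_DMD \<in> carrier_mat n n" unfolding B using A P by auto
  have W: "column_space U \<subseteq> carrier_vec n"
    unfolding column_space_eq_image[OF U] using U by auto
  have agree: "A_DMD *\<^sub>v v = A *\<^sub>v v" if v: "v \<in> column_space U" for v
    using assoc_mult_mat_vec[OF A P] mult_transpose_fixes_column_space[OF U UU v] v W
    unfolding B by auto
  have diff: "(A ^\<^sub>m i - A_DMD ^\<^sub>m i) *\<^sub>v v = A ^\<^sub>m i *\<^sub>v v - A_DMD ^\<^sub>m i *\<^sub>v v"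
    if "v \<in> column_space U" for i v
    using minus_mult_distrib_mat_vec[OF pow_carrier_mat[OF A] pow_carrier_mat[OF Bc]] that W
    by blast
  have diff_zero_iff: "(A ^\<^sub>m i - A_DMD ^\<^sub>m i) *\<^sub>v v = 0\<^sub>v n \<longleftrightarrow> A ^\<^sub>m i *\<^sub>v v = A_DMD ^\<^sub>m i *\<^sub>v v"
    if v: "v \<in> column_space U" for i v
  proof -
    have "A ^\<^sub>m i *\<^sub>v v \<in> carrier_vec n" "A_DMD ^\<^sub>m i *\<^sub>v v \<in> carrier_vec n"
      using pow_carrier_mat[OF A, of i] pow_carrier_mat[OF Bc, of i] v W by auto
    then show ?thesis unfolding diff[OF v] by (rule minus_vec_eq_zero_iff)
  qed
  show ?thesis
  proof (intro conjI impI allI ballI)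
    fix i v
    assume inv: "mat_invariant A_DMD (column_space U)" and v: "v \<in> column_space U"
    show "(A ^\<^sub>m i - A_DMD ^\<^sub>m i) *\<^sub>v v = 0\<^sub>v n"
      using pow_mat_mult_vec_eq_on_invariant[OF A Bc W inv agree v] diff_zero_iff[OF v] by auto
  next
    assume ker: "mat_kernel A \<inter> vec_module.orthogonal_complement n (column_space U) = {0\<^sub>v n}"
      and "\<forall>i. \<forall>v\<in>column_space U. (A ^\<^sub>m i - A_DMD ^\<^sub>m i) *\<^sub>v v = 0\<^sub>v n"
    then have "A ^\<^sub>m 2 *\<^sub>v v = A_DMD ^\<^sub>m 2 *\<^sub>v v" if "v \<in> column_space U" for v
      using diff_zero_iff[OF that] that by blast
    then show "mat_invariant A_DMD (column_space U)"
      by (rule mult_projection_invariant_of_square[OF A U UU B ker])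
  qed
qed

end
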